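(* Let $\Gamma$ be a nonabelian free group of finite rank, with a finite generating set $S$. Then $\Gamma$ is mixed-identity-free and there exists a constant $C>0$ such that $\mathcal{M}_{\Gamma} (n) \leq C\, n \log(n)$ for all integers $n\geq 2$, where $\mathcal M_\Gamma$ is the MIF growth function of $\Gamma$ with respect to $S$.
   Context: Let $\Gamma$ be a group with finite generating set $S$, $|\cdot|_S$ its word length, and $\mathbb Z=\langle x\rangle$ an infinite cyclic group. For $w\in\Gamma*\langle x\rangle$ and $g\in\Gamma$, $w(g)$ denotes the image of $w$ under the homomorphism $\Gamma*\langle x\rangle\to\Gamma$ that is the identity on $\Gamma$ and sends $x\mapsto g$. A mixed identity for $\Gamma$ is a nontrivial $w\in\Gamma*\langle x\rangle$ with $w(g)=e$ for all $g\in\Gamma$; $\Gamma$ is mixed-identity-free (MIF) if it has none. For $\Gamma$ MIF, the complexity of a nontrivial $w$ is $\min\{|g|_S : g\in\Gamma,\ w(g)\ne e\}$, and $\mathcal M_\Gamma(n)$ is the maximal complexity over nontrivial $w\in\Gamma*\langle x\rangle$ of word length at most $n$ with respect to the generating set $S\cup\{x\}$. *)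

theory Defs
  imports Complex_Main "HOL-Algebra.Elementary_Groups"
begin

section \<open>Products of lists and word length\<close>

definition list_prod :: "('a, 'm) monoid_scheme \<Rightarrow> 'a list \<Rightarrow> 'a" where
  "list_prod G ws = foldr (\<lambda>a b. a \<otimes>\<^bsub>G\<^esub> b) ws \<one>\<^bsub>G\<^esub>"

text \<open>Words use the letters of \<open>S\<close> and their inverses. The value is meaningful only for \<open>g\<close> in
  the subgroup generated by \<open>S\<close>.\<close>

definition word_length :: "('a, 'm) monoid_scheme \<Rightarrow> 'a set \<Rightarrow> 'a \<Rightarrow> nat" where
  "word_length G S g =
     (LEAST n. \<exists>ws. set ws \<subseteq> S \<union> m_inv G ` S \<and> list_prod G ws = g \<and> length ws = n)"

section \<open>Free groups\<close>

text \<open>A letter \<open>(True, x)\<close> stands for \<open>x\<close> and \<open>(False, x)\<close> for the inverse of \<open>x\<close>. A group is free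
  on \<open>X\<close> if each of its elements is the value of exactly one reduced word in \<open>X\<close>.\<close>

definition reduced_words :: "'a set \<Rightarrow> (bool \<times> 'a) list set" where
  "reduced_words X =
     {w. set w \<subseteq> UNIV \<times> X \<and> successively (\<lambda>(b, x) (c, y). \<not> (x = y \<and> b \<noteq> c)) w}"

definition word_value :: "('a, 'm) monoid_scheme \<Rightarrow> (bool \<times> 'a) list \<Rightarrow> 'a" where
  "word_value G w = list_prod G (map (\<lambda>(b, x). if b then x else inv\<^bsub>G\<^esub> x) w)"

definition free_basis :: "('a, 'm) monoid_scheme \<Rightarrow> 'a set \<Rightarrow> bool" where
  "free_basis G X \<longleftrightarrow>
     X \<subseteq> carrier G \<and> bij_betw (word_value G) (reduced_words X) (carrier G)"

definition free_group_of_finite_rank :: "('a, 'm) monoid_scheme \<Rightarrow> bool" where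
  "free_group_of_finite_rank G \<longleftrightarrow> group G \<and> (\<exists>X. finite X \<and> free_basis G X)"

section \<open>Free products of two groups\<close>

text \<open>The free product is the monoid of words in the disjoint union of the two carriers, modulo
  the congruence generated by multiplication in each factor and deletion of the units.\<close>

abbreviation fp_words :: "('a, 'm) monoid_scheme \<Rightarrow> ('b, 'n) monoid_scheme \<Rightarrow> ('a + 'b) list set"
  where "fp_words G H \<equiv> lists (carrier G <+> carrier H)"

inductive_set fp_rel ::
  "('a, 'm) monoid_scheme \<Rightarrow> ('b, 'n) monoid_scheme \<Rightarrow> (('a + 'b) list \<times> ('a + 'b) list) set"
  for G :: "('a, 'm) monoid_scheme" and H :: "('b, 'n) monoid_scheme"
where
  refl: "u \<in> fp_words G H \<Longrightarrow> (u, u) \<in> fp_rel G H"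
| sym: "(u, v) \<in> fp_rel G H \<Longrightarrow> (v, u) \<in> fp_rel G H"
| trans: "(u, v) \<in> fp_rel G H \<Longrightarrow> (v, w) \<in> fp_rel G H \<Longrightarrow> (u, w) \<in> fp_rel G H"
| append: "(u, u') \<in> fp_rel G H \<Longrightarrow> (v, v') \<in> fp_rel G H \<Longrightarrow> (u @ v, u' @ v') \<in> fp_rel G H"
| mult_left: "a \<in> carrier G \<Longrightarrow> b \<in> carrier G \<Longrightarrow>
    ([Inl a, Inl b], [Inl (a \<otimes>\<^bsub>G\<^esub> b)]) \<in> fp_rel G H"
| mult_right: "c \<in> carrier H \<Longrightarrow> d \<in> carrier H \<Longrightarrow>
    ([Inr c, Inr d], [Inr (c \<otimes>\<^bsub>H\<^esub> d)]) \<in> fp_rel G H"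
| one_left: "\<one>\<^bsub>G\<^esub> \<in> carrier G \<Longrightarrow> ([Inl \<one>\<^bsub>G\<^esub>], []) \<in> fp_rel G H"
| one_right: "\<one>\<^bsub>H\<^esub> \<in> carrier H \<Longrightarrow> ([Inr \<one>\<^bsub>H\<^esub>], []) \<in> fp_rel G H"

definition free_product ::
  "('a, 'm) monoid_scheme \<Rightarrow> ('b, 'n) monoid_scheme \<Rightarrow> ('a + 'b) list set monoid" where
  "free_product G H =
     \<lparr>carrier = fp_words G H // fp_rel G H,
      monoid.mult = (\<lambda>A B. \<Union>u\<in>A. \<Union>v\<in>B. fp_rel G H `` {u @ v}),
      one = fp_rel G H `` {[]}\<rparr>"

definition fp_inl ::
  "('a, 'm) monoid_scheme \<Rightarrow> ('b, 'n) monoid_scheme \<Rightarrow> 'a \<Rightarrow> ('a + 'b) list set" where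
  "fp_inl G H a = fp_rel G H `` {[Inl a]}"

definition fp_inr ::
  "('a, 'm) monoid_scheme \<Rightarrow> ('b, 'n) monoid_scheme \<Rightarrow> 'b \<Rightarrow> ('a + 'b) list set" where
  "fp_inr G H b = fp_rel G H `` {[Inr b]}"

text \<open>The homomorphism from the free product to \<open>K\<close> that extends \<open>\<phi>\<close> and \<open>\<psi>\<close>. If these are
  homomorphisms, equivalent words have the same value, so the image of a class is a singleton.\<close>

definition fp_lift ::
  "('k, 'l) monoid_scheme \<Rightarrow> ('a \<Rightarrow> 'k) \<Rightarrow> ('b \<Rightarrow> 'k) \<Rightarrow> ('a + 'b) list set \<Rightarrow> 'k" where
  "fp_lift K \<phi> \<psi> W = the_elem ((\<lambda>w. list_prod K (map (case_sum \<phi> \<psi>) w)) ` W)"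

lemma list_prod_simps [simp]:
  "list_prod G [] = \<one>\<^bsub>G\<^esub>" "list_prod G (a # ws) = a \<otimes>\<^bsub>G\<^esub> list_prod G ws"
  by (simp_all add: list_prod_def)

lemma (in monoid) list_prod_closed: "set ws \<subseteq> carrier G \<Longrightarrow> list_prod G ws \<in> carrier G"
  by (induction ws) auto

lemma (in monoid) list_prod_append:
  "set us \<subseteq> carrier G \<Longrightarrow> set vs \<subseteq> carrier G \<Longrightarrow>
   list_prod G (us @ vs) = list_prod G us \<otimes> list_prod G vs"
  by (induction us) (auto simp: list_prod_closed m_assoc)

lemma Plus_letter_iff [simp]: "Inl a \<in> A <+> B \<longleftrightarrow> a \<in> A" "Inr b \<in> A <+> B \<longleftrightarrow> b \<in> B"
  by auto

context
  fixes G :: "('a, 'm) monoid_scheme" and H :: "('b, 'n) monoid_scheme"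
  assumes G: "group G" and H: "group H"
begin

interpretation G: group G by (rule G)
interpretation H: group H by (rule H)

lemma fp_rel_in_words: "(u, v) \<in> fp_rel G H \<Longrightarrow> u \<in> fp_words G H \<and> v \<in> fp_words G H"
  by (induction rule: fp_rel.induct) auto

lemma equiv_fp_rel: "equiv (fp_words G H) (fp_rel G H)"
proof (intro equivI refl_onI symI transI)
  show "fp_rel G H \<subseteq> fp_words G H \<times> fp_words G H" using fp_rel_in_words by auto
qed (fact fp_rel.intros)+

lemma fp_mult_class:
  assumes "u \<in> fp_words G H" "v \<in> fp_words G H"
  shows "fp_rel G H `` {u} \<otimes>\<^bsub>free_product G H\<^esub> fp_rel G H `` {v} = fp_rel G H `` {u @ v}"
proof -
  have "fp_rel G H `` {u' @ v'} = fp_rel G H `` {u @ v}"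
    if "u' \<in> fp_rel G H `` {u}" "v' \<in> fp_rel G H `` {v}" for u' v'
    using equiv_class_eq[OF equiv_fp_rel fp_rel.append[of u u' G H v v']] that by simp
  then have "(\<Union>u' \<in> fp_rel G H `` {u}. \<Union>v' \<in> fp_rel G H `` {v}. fp_rel G H `` {u' @ v'}) =
      (\<Union>u' \<in> fp_rel G H `` {u}. \<Union>v' \<in> fp_rel G H `` {v}. fp_rel G H `` {u @ v})"
    by (intro SUP_cong HOL.refl)
  moreover have "u \<in> fp_rel G H `` {u}" "v \<in> fp_rel G H `` {v}"
    using assms by (auto intro: fp_rel.refl)
  ultimately show ?thesis
    unfolding free_product_def by auto
qed

lemma fp_class_in_carrier: "u \<in> fp_words G H \<Longrightarrow> fp_rel G H `` {u} \<in> carrier (free_product G H)"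
  by (simp add: free_product_def quotientI)

lemma fp_carrierE:
  assumes "A \<in> carrier (free_product G H)"
  obtains u where "u \<in> fp_words G H" "A = fp_rel G H `` {u}"
  using assms quotientE[of A "fp_words G H" "fp_rel G H"] by (auto simp: free_product_def)

lemma fp_one: "\<one>\<^bsub>free_product G H\<^esub> = fp_rel G H `` {[]}"
  by (simp add: free_product_def)

lemma fp_left_inverse:
  "u \<in> fp_words G H \<Longrightarrow> \<exists>v \<in> fp_words G H. (v @ u, []) \<in> fp_rel G H"
proof (induction u)
  case Nil
  then show ?case by (intro bexI[of _ "[]"]) (auto intro: fp_rel.refl)
next
  case (Cons l u)
  then obtain v where v: "v \<in> fp_words G H" "(v @ u, []) \<in> fp_rel G H" by auto
  obtain l' where l': "l' \<in> carrier G <+> carrier H" "([l', l], []) \<in> fp_rel G H"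
  proof (cases l)
    case (Inl a)
    then have a: "a \<in> carrier G" using Cons.prems by auto
    have "([Inl (inv\<^bsub>G\<^esub> a), Inl a], []) \<in> fp_rel G H"
      using fp_rel.mult_left[of "inv\<^bsub>G\<^esub> a" G a H] fp_rel.one_left[of G H] a
      by (metis fp_rel.trans G.inv_closed G.l_inv G.one_closed)
    then show ?thesis using that[of "Inl (inv\<^bsub>G\<^esub> a)"] a Inl by auto
  next
    case (Inr b)
    then have b: "b \<in> carrier H" using Cons.prems by auto
    have "([Inr (inv\<^bsub>H\<^esub> b), Inr b], []) \<in> fp_rel G H"
      using fp_rel.mult_right[of "inv\<^bsub>H\<^esub> b" H b G] fp_rel.one_right[of H G] b
      by (metis fp_rel.trans H.inv_closed H.l_inv H.one_closed)
    then show ?thesis using that[of "Inr (inv\<^bsub>H\<^esub> b)"] b Inr by auto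
  qed
  have "((v @ [l', l]) @ u, (v @ []) @ u) \<in> fp_rel G H"
    using v l' Cons.prems by (intro fp_rel.append fp_rel.refl) auto
  then have "((v @ [l']) @ l # u, []) \<in> fp_rel G H"
    using v(2) fp_rel.trans[of "v @ [l', l] @ u" "v @ u" G H "[]"] by simp
  then show ?case using v l' by (intro bexI[of _ "v @ [l']"]) auto
qed

lemma group_free_product: "group (free_product G H)"
proof (rule groupI)
  fix A B assume "A \<in> carrier (free_product G H)" "B \<in> carrier (free_product G H)"
  then show "A \<otimes>\<^bsub>free_product G H\<^esub> B \<in> carrier (free_product G H)"
    by (elim fp_carrierE) (simp add: fp_mult_class fp_class_in_carrier)
next
  show "\<one>\<^bsub>free_product G H\<^esub> \<in> carrier (free_product G H)"
    by (simp add: fp_one fp_class_in_carrier)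
next
  fix A B C assume "A \<in> carrier (free_product G H)" "B \<in> carrier (free_product G H)"
    "C \<in> carrier (free_product G H)"
  then show "A \<otimes>\<^bsub>free_product G H\<^esub> B \<otimes>\<^bsub>free_product G H\<^esub> C =
      A \<otimes>\<^bsub>free_product G H\<^esub> (B \<otimes>\<^bsub>free_product G H\<^esub> C)"
    by (elim fp_carrierE) (simp add: fp_mult_class)
next
  fix A assume "A \<in> carrier (free_product G H)"
  then show "\<one>\<^bsub>free_product G H\<^esub> \<otimes>\<^bsub>free_product G H\<^esub> A = A"
    by (elim fp_carrierE) (simp add: fp_mult_class fp_one)
next
  fix A assume "A \<in> carrier (free_product G H)"
  then obtain u where u: "u \<in> fp_words G H" "A = fp_rel G H `` {u}" by (rule fp_carrierE)
  obtain v where v: "v \<in> fp_words G H" "(v @ u, []) \<in> fp_rel G H"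
    using fp_left_inverse[OF u(1)] by blast
  then show "\<exists>B \<in> carrier (free_product G H). B \<otimes>\<^bsub>free_product G H\<^esub> A = \<one>\<^bsub>free_product G H\<^esub>"
    using u equiv_class_eq[OF equiv_fp_rel v(2)]
    by (intro bexI[of _ "fp_rel G H `` {v}"])
       (auto simp: fp_mult_class fp_one fp_class_in_carrier)
qed

lemma fp_inl_hom: "fp_inl G H \<in> hom G (free_product G H)"
  by (intro homI)
     (simp_all add: fp_inl_def fp_mult_class fp_class_in_carrier
        equiv_class_eq[OF equiv_fp_rel fp_rel.mult_left])

lemma fp_inr_hom: "fp_inr G H \<in> hom H (free_product G H)"
  by (intro homI)
     (simp_all add: fp_inr_def fp_mult_class fp_class_in_carrier
        equiv_class_eq[OF equiv_fp_rel fp_rel.mult_right])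

context
  fixes K :: "('k, 'l) monoid_scheme" and \<phi> \<psi>
  assumes K: "group K" and \<phi>: "\<phi> \<in> hom G K" and \<psi>: "\<psi> \<in> hom H K"
begin

interpretation K: group K by (rule K)
interpretation \<phi>: group_hom G K \<phi>
  using G K \<phi> by (simp add: group_hom_def group_hom_axioms_def)
interpretation \<psi>: group_hom H K \<psi>
  using H K \<psi> by (simp add: group_hom_def group_hom_axioms_def)

lemma fp_map_closed: "u \<in> fp_words G H \<Longrightarrow> set (map (case_sum \<phi> \<psi>) u) \<subseteq> carrier K"
  by auto

lemma fp_value_cong:
  "(u, v) \<in> fp_rel G H \<Longrightarrow>
   list_prod K (map (case_sum \<phi> \<psi>) u) = list_prod K (map (case_sum \<phi> \<psi>) v)"
proof (induction rule: fp_rel.induct)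
  case (append u u' v v')
  then show ?case
    using fp_rel_in_words[OF append.hyps(1)] fp_rel_in_words[OF append.hyps(2)]
    by (simp add: K.list_prod_append fp_map_closed del: set_map)
qed (auto simp: K.m_assoc)

lemma fp_lift_class:
  assumes "u \<in> fp_words G H"
  shows "fp_lift K \<phi> \<psi> (fp_rel G H `` {u}) = list_prod K (map (case_sum \<phi> \<psi>) u)"
proof -
  have "list_prod K (map (case_sum \<phi> \<psi>) v) = list_prod K (map (case_sum \<phi> \<psi>) u)"
    if "v \<in> fp_rel G H `` {u}" for v
    using fp_value_cong[of u v] that by simp
  moreover have "u \<in> fp_rel G H `` {u}"
    using fp_rel.refl[OF assms] by simp
  ultimately show ?thesis
    unfolding fp_lift_def by (intro the_elem_image_unique) blast+
qed

lemma fp_lift_hom: "fp_lift K \<phi> \<psi> \<in> hom (free_product G H) K"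
proof (rule homI)
  fix A assume "A \<in> carrier (free_product G H)"
  then show "fp_lift K \<phi> \<psi> A \<in> carrier K"
    by (elim fp_carrierE)
       (simp add: fp_lift_class K.list_prod_closed fp_map_closed del: set_map)
next
  fix A B assume "A \<in> carrier (free_product G H)" "B \<in> carrier (free_product G H)"
  then show "fp_lift K \<phi> \<psi> (A \<otimes>\<^bsub>free_product G H\<^esub> B) =
      fp_lift K \<phi> \<psi> A \<otimes>\<^bsub>K\<^esub> fp_lift K \<phi> \<psi> B"
    by (elim fp_carrierE)
       (simp add: fp_mult_class fp_lift_class K.list_prod_append fp_map_closed del: set_map)
qed

lemma fp_lift_inl: "a \<in> carrier G \<Longrightarrow> fp_lift K \<phi> \<psi> (fp_inl G H a) = \<phi> a"
  by (simp add: fp_inl_def fp_lift_class)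

lemma fp_lift_inr: "b \<in> carrier H \<Longrightarrow> fp_lift K \<phi> \<psi> (fp_inr G H b) = \<psi> b"
  by (simp add: fp_inr_def fp_lift_class)

lemma fp_lift_unique:
  assumes \<theta>: "\<theta> \<in> hom (free_product G H) K"
    and l: "\<And>a. a \<in> carrier G \<Longrightarrow> \<theta> (fp_inl G H a) = \<phi> a"
    and r: "\<And>b. b \<in> carrier H \<Longrightarrow> \<theta> (fp_inr G H b) = \<psi> b"
    and A: "A \<in> carrier (free_product G H)"
  shows "\<theta> A = fp_lift K \<phi> \<psi> A"
proof -
  interpret \<theta>: group_hom "free_product G H" K \<theta>
    using group_free_product K \<theta> by (simp add: group_hom_def group_hom_axioms_def)
  have "\<theta> (fp_rel G H `` {u}) = list_prod K (map (case_sum \<phi> \<psi>) u)" if "u \<in> fp_words G H" for u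
    using that
  proof (induction u rule: list.induct)
    case Nil
    then show ?case using \<theta>.hom_one by (simp add: fp_one)
  next
    case (Cons c u)
    have c: "[c] \<in> fp_words G H" and u: "u \<in> fp_words G H"
      using Cons.prems by auto
    have "\<theta> (fp_rel G H `` {c # u}) = \<theta> (fp_rel G H `` {[c]} \<otimes>\<^bsub>free_product G H\<^esub> fp_rel G H `` {u})"
      using fp_mult_class[OF c u] by simp
    also have "\<dots> = \<theta> (fp_rel G H `` {[c]}) \<otimes>\<^bsub>K\<^esub> \<theta> (fp_rel G H `` {u})"
      using c u by (intro \<theta>.hom_mult fp_class_in_carrier)
    also have "\<theta> (fp_rel G H `` {[c]}) = case_sum \<phi> \<psi> c"
      using c l r by (cases c) (simp_all add: fp_inl_def fp_inr_def)
    finally show ?case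
      using Cons.IH[OF u] by simp
  qed
  then show ?thesis using A by (elim fp_carrierE) (simp add: fp_lift_class)
qed

end

end

section \<open>Mixed identities and the MIF growth function\<close>

abbreviation mixed_words :: "('a, 'm) monoid_scheme \<Rightarrow> ('a + int) list set monoid" where
  "mixed_words G \<equiv> free_product G integer_group"

definition mixed_var :: "('a, 'm) monoid_scheme \<Rightarrow> ('a + int) list set" where
  "mixed_var G = fp_inr G integer_group 1"

text \<open>The value \<open>w(g)\<close>.\<close>

definition mixed_eval :: "('a, 'm) monoid_scheme \<Rightarrow> ('a + int) list set \<Rightarrow> 'a \<Rightarrow> 'a" where
  "mixed_eval G w g = fp_lift G (\<lambda>a. a) (\<lambda>k :: int. g [^]\<^bsub>G\<^esub> k) w"

lemma (in group)
  assumes g: "g \<in> carrier G"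
  shows mixed_eval_hom: "(\<lambda>w. mixed_eval G w g) \<in> hom (mixed_words G) G"
    and mixed_eval_const: "a \<in> carrier G \<Longrightarrow> mixed_eval G (fp_inl G integer_group a) g = a"
    and mixed_eval_var: "mixed_eval G (mixed_var G) g = g"
proof -
  have id: "(\<lambda>a. a) \<in> hom G G" by (simp add: hom_def)
  note [simp] = id hom_integer_group_pow[OF g]
  show "(\<lambda>w. mixed_eval G w g) \<in> hom (mixed_words G) G"
    unfolding mixed_eval_def by (rule fp_lift_hom) simp_all
  show "mixed_eval G (fp_inl G integer_group a) g = a" if "a \<in> carrier G"
    unfolding mixed_eval_def using that by (subst fp_lift_inl) simp_all
  show "mixed_eval G (mixed_var G) g = g"
    unfolding mixed_eval_def mixed_var_def using g by (subst fp_lift_inr) simp_all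
qed

definition mixed_identity :: "('a, 'm) monoid_scheme \<Rightarrow> ('a + int) list set \<Rightarrow> bool" where
  "mixed_identity G w \<longleftrightarrow>
     w \<in> carrier (mixed_words G) \<and> w \<noteq> \<one>\<^bsub>mixed_words G\<^esub> \<and>
     (\<forall>g \<in> carrier G. mixed_eval G w g = \<one>\<^bsub>G\<^esub>)"

definition mixed_identity_free :: "('a, 'm) monoid_scheme \<Rightarrow> bool" where
  "mixed_identity_free G \<longleftrightarrow> \<not> (\<exists>w. mixed_identity G w)"

definition mixed_word_length ::
  "('a, 'm) monoid_scheme \<Rightarrow> 'a set \<Rightarrow> ('a + int) list set \<Rightarrow> nat" where
  "mixed_word_length G S =
     word_length (mixed_words G) (insert (mixed_var G) (fp_inl G integer_group ` S))"

definition mixed_complexity ::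
  "('a, 'm) monoid_scheme \<Rightarrow> 'a set \<Rightarrow> ('a + int) list set \<Rightarrow> nat" where
  "mixed_complexity G S w =
     (LEAST k. \<exists>g \<in> carrier G. mixed_eval G w g \<noteq> \<one>\<^bsub>G\<^esub> \<and> word_length G S g = k)"

text \<open>If \<open>S\<close> is a finite generating set of a nontrivial MIF group, the set below is finite, and it is
  nonempty for \<open>n \<ge> 1\<close>.\<close>

definition mif_growth :: "('a, 'm) monoid_scheme \<Rightarrow> 'a set \<Rightarrow> nat \<Rightarrow> nat" where
  "mif_growth G S n =
     Max {mixed_complexity G S w | w. w \<in> carrier (mixed_words G) \<and>
            w \<noteq> \<one>\<^bsub>mixed_words G\<^esub> \<and> mixed_word_length G S w \<le> n}"

end

theory Submission
  imports Defs
begin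

text \<open>The growth is in fact at most linear. Let \<open>a \<noteq> b\<close> be basis elements and put
  \<open>g = a\<^sup>N b\<^sup>-\<^sup>N\<close>, where \<open>N\<close> exceeds the length in the basis of every coefficient of
  \<open>w = h\<^sub>0 x\<^sup>\<plusminus>\<^sup>1 h\<^sub>1 x\<^sup>\<plusminus>\<^sup>1 \<dots> h\<^sub>m\<close>. By induction on the suffixes of \<open>w(g)\<close> starting at an occurrence of
  \<open>g\<^sup>\<plusminus>\<^sup>1\<close>, such a suffix is \<open>a\<^sup>N r\<close> or \<open>b\<^sup>N r\<close> respectively, where the reduced word of \<open>r\<close> starts with
  a different basis element: a coefficient is too short to cancel a whole power \<open>a\<^sup>N\<close> or \<open>b\<^sup>N\<close>, and
  conjugating a nontrivial short coefficient by \<open>a\<^sup>N\<close> leaves a letter \<open>a\<^sup>\<plusminus>\<^sup>1\<close> in front.\<close>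

section \<open>Words and generation\<close>

lemma (in group) generate_list_prod:
  assumes "S \<subseteq> carrier G" "g \<in> generate G S"
  shows "\<exists>ws. set ws \<subseteq> S \<union> m_inv G ` S \<and> list_prod G ws = g"
  using assms(2)
proof (induction rule: generate.induct)
  case one
  show ?case by (intro exI[of _ "[]"]) simp
next
  case (incl h)
  then show ?case using assms(1) by (intro exI[of _ "[h]"]) auto
next
  case (inv h)
  then show ?case using assms(1) by (intro exI[of _ "[inv h]"]) auto
next
  case (eng h k)
  then obtain us vs where uv: "set us \<subseteq> S \<union> m_inv G ` S" "list_prod G us = h"
    "set vs \<subseteq> S \<union> m_inv G ` S" "list_prod G vs = k" by blast
  have "S \<union> m_inv G ` S \<subseteq> carrier G" using assms(1) by auto
  then have "set us \<subseteq> carrier G" "set vs \<subseteq> carrier G" using uv by blast+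
  then show ?case
    using uv by (intro exI[of _ "us @ vs"]) (simp add: list_prod_append)
qed

text \<open>Generation makes the set of possible lengths nonempty, so the \<open>LEAST\<close> in
  \<open>word_length\<close> is attained by an actual word.\<close>

lemma (in group) word_length_witness:
  assumes "S \<subseteq> carrier G" "g \<in> generate G S"
  obtains ws where "set ws \<subseteq> S \<union> m_inv G ` S" "list_prod G ws = g"
    "length ws = word_length G S g"
proof -
  let ?P = "\<lambda>n. \<exists>ws. set ws \<subseteq> S \<union> m_inv G ` S \<and> list_prod G ws = g \<and> length ws = n"
  have "\<exists>n. ?P n" using generate_list_prod[OF assms] by blast
  then have "?P (word_length G S g)" unfolding word_length_def by (rule LeastI_ex)
  then show ?thesis using that by blast
qed

lemma word_length_le:
  "set ws \<subseteq> S \<union> m_inv G ` S \<Longrightarrow> word_length G S (list_prod G ws) \<le> length ws"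
  unfolding word_length_def by (rule Least_le) blast

lemma (in group) word_length_mult_le:
  assumes S: "S \<subseteq> carrier G" and "g \<in> generate G S" "h \<in> generate G S"
  shows "word_length G S (g \<otimes> h) \<le> word_length G S g + word_length G S h"
proof -
  obtain us where us: "set us \<subseteq> S \<union> m_inv G ` S" "list_prod G us = g"
    "length us = word_length G S g" using word_length_witness[OF S assms(2)] .
  obtain vs where vs: "set vs \<subseteq> S \<union> m_inv G ` S" "list_prod G vs = h"
    "length vs = word_length G S h" using word_length_witness[OF S assms(3)] .
  have "S \<union> m_inv G ` S \<subseteq> carrier G" using S by auto
  then have "list_prod G (us @ vs) = g \<otimes> h" using us vs by (subst list_prod_append) auto
  then show ?thesis using word_length_le[of "us @ vs" S G] us vs by simp
qed

lemma (in group) word_length_pow_le: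
  assumes S: "S \<subseteq> carrier G" and g: "g \<in> generate G S"
  shows "word_length G S (g [^] (n :: nat)) \<le> n * word_length G S g"
proof (induction n)
  case 0
  show ?case using word_length_le[of "[]" S G] by simp
next
  case (Suc n)
  have "g [^] n \<in> generate G S"
    using subgroup_int_pow_closed[OF generate_is_subgroup[OF S] g, of "int n"]
    by (simp add: int_pow_int)
  then show ?case using word_length_mult_le[OF S _ g, of "g [^] n"] Suc by simp
qed

section \<open>Syllable form of words in constants and a variable\<close>

text \<open>The target group and the map on constants are parameters, so that one syllable list
  describes both a mixed word (\<open>\<phi>\<close> the inclusion of constants) and its value at a
  group element (\<open>\<phi>\<close> the identity).\<close>

fun syllable_prod :: "('k, 'l) monoid_scheme \<Rightarrow> ('a \<Rightarrow> 'k) \<Rightarrow> 'k \<Rightarrow> (bool \<times> 'a) list \<Rightarrow> 'k" where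
  "syllable_prod K \<phi> x [] = \<one>\<^bsub>K\<^esub>"
| "syllable_prod K \<phi> x ((e, g) # es) =
     (if e then x else inv\<^bsub>K\<^esub> x) \<otimes>\<^bsub>K\<^esub> (\<phi> g \<otimes>\<^bsub>K\<^esub> syllable_prod K \<phi> x es)"

text \<open>Only a trivial constant between opposite exponents is forbidden. Trivial constants
  between equal exponents remain, so higher powers of the variable are spelled out as repeated
  syllables.\<close>

abbreviation reduced_syllables :: "('a, 'm) monoid_scheme \<Rightarrow> (bool \<times> 'a) list \<Rightarrow> bool" where
  "reduced_syllables G \<equiv> successively (\<lambda>(e, g) (e', g'). \<not> (g = \<one>\<^bsub>G\<^esub> \<and> e \<noteq> e'))"

lemma (in group_hom) syllable_prod_closed:
  "x \<in> carrier H \<Longrightarrow> snd ` set es \<subseteq> carrier G \<Longrightarrow> syllable_prod H h x es \<in> carrier H"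
  by (induction es) auto

text \<open>Letters are put in front one at a time: a constant is absorbed into the leading
  coefficient \<open>g\<close>, and a variable either opens a new syllable or cancels the first one.
  Each coefficient thus collects at most \<open>length ws\<close> letters from \<open>S\<close>. The
  function \<open>\<nu>\<close> will be the length in the free basis.\<close>

lemma (in group_hom) syllable_form:
  fixes \<nu> :: "'a \<Rightarrow> nat"
  assumes x: "x \<in> carrier H" and S: "S \<subseteq> carrier G" and \<nu>1: "\<nu> \<one> = 0"
    and \<nu>: "\<And>s g. s \<in> S \<union> m_inv G ` S \<Longrightarrow> g \<in> carrier G \<Longrightarrow> \<nu> (s \<otimes> g) \<le> D + \<nu> g"
    and ws: "set ws \<subseteq> insert x (h ` S) \<union> m_inv H ` insert x (h ` S)"
  shows "\<exists>g es. g \<in> carrier G \<and> snd ` set es \<subseteq> carrier G \<and> reduced_syllables G es \<and>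
    (\<forall>g' \<in> insert g (snd ` set es). \<nu> g' \<le> D * length ws) \<and>
    list_prod H ws = h g \<otimes>\<^bsub>H\<^esub> syllable_prod H h x es"
  using ws
proof (induction ws)
  case Nil
  show ?case by (intro exI[of _ "\<one>"] exI[of _ "[]"]) (simp add: \<nu>1)
next
  case (Cons c ws)
  then obtain g es where IH: "g \<in> carrier G" "snd ` set es \<subseteq> carrier G" "reduced_syllables G es"
    "\<forall>g' \<in> insert g (snd ` set es). \<nu> g' \<le> D * length ws"
    "list_prod H ws = h g \<otimes>\<^bsub>H\<^esub> syllable_prod H h x es"
    by auto
  note P = syllable_prod_closed[OF x IH(2)]
  have le: "D * length ws \<le> D * length (c # ws)" by simp
  have "(\<exists>s \<in> S \<union> m_inv G ` S. c = h s) \<or> (\<exists>e. c = (if e then x else inv\<^bsub>H\<^esub> x))"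
  proof -
    have "inv\<^bsub>H\<^esub> h s = h (inv s)" if "s \<in> S" for s using that S by auto
    then show ?thesis using Cons.prems by (auto split: if_splits)
  qed
  then consider (const) s where "s \<in> S \<union> m_inv G ` S" "c = h s"
    | (var) e where "c = (if e then x else inv\<^bsub>H\<^esub> x)" by blast
  then show ?case
  proof cases
    case const
    then have s: "s \<in> carrier G" using S by auto
    show ?thesis
    proof (intro exI[of _ "s \<otimes> g"] exI[of _ es] conjI ballI)
      fix g' assume "g' \<in> insert (s \<otimes> g) (snd ` set es)"
      then show "\<nu> g' \<le> D * length (c # ws)" using \<nu>[OF const(1) IH(1)] IH(4) le by force
    qed (use s IH P const in \<open>auto simp: H.m_assoc\<close>)
  next
    case var
    have c: "c \<in> carrier H" using var x by auto
    show ?thesis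
    \<comment> \<open>The new variable cancels the first syllable exactly when it meets the opposite
      exponent across a trivial coefficient; then \<open>g'\<close> becomes the leading one.
      Otherwise \<open>g\<close> moves into the new syllable and the leading coefficient restarts at
      \<open>\<one>\<close>.\<close>
    proof (cases "\<exists>g' es'. es = (\<not> e, g') # es' \<and> g = \<one>")
      case True
      then obtain g' es' where es: "es = (\<not> e, g') # es'" "g = \<one>" by blast
      have g': "g' \<in> carrier G" and P': "syllable_prod H h x es' \<in> carrier H"
        using IH(2) es x by (auto intro!: syllable_prod_closed)
      have "list_prod H (c # ws) = h g' \<otimes>\<^bsub>H\<^esub> syllable_prod H h x es'"
        using IH(5) es var x g' P' by (auto simp: H.m_assoc[symmetric])
      then show ?thesis
        using IH es le by (intro exI[of _ g'] exI[of _ es']) (auto simp: successively_Cons)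
    next
      case False
      then have "reduced_syllables G ((e, g) # es)"
        using IH(3) by (cases es) auto
      then show ?thesis
        using IH le var P c
        by (intro exI[of _ "\<one>"] exI[of _ "(e, g) # es"]) (auto simp: \<nu>1)
    qed
  qed
qed

section \<open>Multiplying reduced words by letters\<close>

definition letter_inv :: "bool \<times> 'a \<Rightarrow> bool \<times> 'a" where
  "letter_inv l = (\<not> fst l, snd l)"

text \<open>On reduced words this is left multiplication by a letter, where at most one cancellation
  can occur, at the front. The lemmas of this section hold for arbitrary lists.\<close>

definition letter_cons :: "bool \<times> 'a \<Rightarrow> (bool \<times> 'a) list \<Rightarrow> (bool \<times> 'a) list" where
  "letter_cons l w = (if w \<noteq> [] \<and> hd w = letter_inv l then tl w else l # w)"

lemma letter_cons_simps [simp]: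
  "letter_cons l [] = [l]"
  "letter_cons l (m # w) = (if m = letter_inv l then w else l # m # w)"
  by (simp_all add: letter_cons_def)

lemma letter_inv_inv [simp]: "letter_inv (letter_inv l) = l"
  by (simp add: letter_inv_def)

lemma letter_inv_neq [simp]: "l \<noteq> letter_inv l" "letter_inv l \<noteq> l"
  by (cases l; simp add: letter_inv_def)+

lemma snd_letter_inv [simp]: "snd (letter_inv l) = snd l"
  by (simp add: letter_inv_def)

lemma letter_cons_cancel: "(letter_cons (letter_inv l) ^^ k) (replicate k l @ v) = v"
  by (induction k) (simp_all add: funpow_swap1 letter_cons_def del: funpow.simps add: funpow_Suc_right)

lemma letter_cons_push:
  "v = [] \<or> hd v \<noteq> letter_inv l \<Longrightarrow> (letter_cons l ^^ k) v = replicate k l @ v"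
  by (induction k) (auto simp: letter_cons_def hd_append)

text \<open>Each letter of \<open>h\<close> either cancels one letter or adds one, so the block
  loses at most \<open>length h\<close> of its copies and \<open>r\<close> stays untouched behind
  it.\<close>

lemma foldr_letter_cons_replicate:
  assumes "length h \<le> N"
  shows "\<exists>u k. foldr letter_cons h (replicate N l @ r) = u @ replicate k l @ r \<and>
    N \<le> k + length h \<and> length u \<le> length h"
  using assms
proof (induction h)
  case Nil
  then show ?case by (intro exI[of _ "[]"] exI[of _ N]) simp
next
  case (Cons c h)
  then obtain u k where IH: "foldr letter_cons h (replicate N l @ r) = u @ replicate k l @ r"
    "N \<le> k + length h" "length u \<le> length h" by auto
  \<comment> \<open>With \<open>c\<close> still to come, \<open>length h < N\<close>, so some copy
    of \<open>l\<close> is left to shield \<open>r\<close> from cancellation.\<close>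
  then obtain k' where k: "k = Suc k'" using Cons.prems by (cases k) auto
  show ?case
  proof (cases "u = [] \<and> c = letter_inv l")
    case True
    then show ?thesis using IH k by (intro exI[of _ "[]"] exI[of _ k']) auto
  next
    case False
    show ?thesis
    proof (cases "u \<noteq> [] \<and> hd u = letter_inv c")
      case True
      then show ?thesis using IH
        by (cases u) (auto intro!: exI[of _ "tl u"] exI[of _ k])
    next
      case F: False
      have "letter_cons c (u @ replicate k l @ r) = (c # u) @ replicate k l @ r"
        using F False k by (cases u) (auto simp: letter_cons_def)
      then show ?thesis using IH
        by (intro exI[of _ "c # u"] exI[of _ k]) auto
    qed
  qed
qed

text \<open>Comparing the length of the maximal leading run of \<open>l\<close> with N decides what
  multiplication by the N-th power of the inverse letter leaves in front.\<close>

lemma letter_run: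
  obtains p v' where "v = replicate p l @ v'" "v' = [] \<or> hd v' \<noteq> l"
proof -
  have "\<exists>p v'. v = replicate p l @ v' \<and> (v' = [] \<or> hd v' \<noteq> l)"
  proof (induction v)
    case Nil
    show ?case by simp
  next
    case (Cons c v)
    then obtain p v' where v: "v = replicate p l @ v'" "v' = [] \<or> hd v' \<noteq> l" by blast
    show ?case
    proof (cases "c = l")
      case True
      then show ?thesis using v by (intro exI[of _ "Suc p"] exI[of _ v']) simp
    next
      case False
      then show ?thesis by (intro exI[of _ 0] exI[of _ "c # v"]) simp
    qed
  qed
  then show ?thesis using that by blast
qed

text \<open>The remainder behind a maximal leading run is recovered from the whole word, so two such
  decompositions of one word have the same remainder.\<close>

lemma dropWhile_run:
  "v = [] \<or> hd v \<noteq> l \<Longrightarrow> dropWhile ((=) l) (replicate k l @ v) = v"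
  by (induction k) (cases v; auto)+

text \<open>After p cancellations the run is used up, and the remaining N - p inverse letters pile
  up in front of \<open>v'\<close>.\<close>

lemma letter_cons_run_less:
  assumes "p < N" "v' = [] \<or> hd v' \<noteq> l"
  shows "\<exists>w. (letter_cons (letter_inv l) ^^ N) (replicate p l @ v') = letter_inv l # w"
proof -
  have "(letter_cons (letter_inv l) ^^ N) (replicate p l @ v') =
      (letter_cons (letter_inv l) ^^ (N - p)) ((letter_cons (letter_inv l) ^^ p) (replicate p l @ v'))"
    using assms(1) by (metis comp_apply funpow_add le_add_diff_inverse2 less_imp_le)
  also have "\<dots> = replicate (N - p) (letter_inv l) @ v'"
    using assms(2) by (simp add: letter_cons_cancel letter_cons_push)
  finally show ?thesis using assms(1) by (cases "N - p") auto
qed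

text \<open>Only N copies of \<open>l\<close> are cancelled, so one stays in front. Together with
  the previous lemma, a run of length exactly N is the only case in which both \<open>l\<close> and
  its inverse may vanish from the front.\<close>

lemma letter_cons_run_greater:
  assumes "N < p"
  shows "\<exists>w. (letter_cons (letter_inv l) ^^ N) (replicate p l @ v') = l # w"
proof -
  obtain k where "p = N + Suc k" using assms less_natE by auto
  then have "replicate p l @ v' = replicate N l @ l # replicate k l @ v'"
    by (simp only: replicate_add append_assoc replicate_Suc append_Cons)
  then show ?thesis by (simp only: letter_cons_cancel) blast
qed

text \<open>Both signs of \<open>y\<close> are excluded, so a positive power of \<open>y\<close> put
  in front of \<open>v\<close> neither cancels nor merges with a longer run.\<close>

definition starts_off :: "'a \<Rightarrow> (bool \<times> 'a) list \<Rightarrow> bool" where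
  "starts_off y v \<longleftrightarrow> v = [] \<or> snd (hd v) \<noteq> y"

section \<open>Normal forms in a free group\<close>

locale group_with_free_basis = group G for G (structure) +
  fixes X
  assumes basis: "free_basis G X"
begin

definition nf :: "'a \<Rightarrow> (bool \<times> 'a) list" where
  "nf = the_inv_into (reduced_words X) (word_value G)"

definition letter_value :: "bool \<times> 'a \<Rightarrow> 'a" where
  "letter_value l = (if fst l then snd l else inv (snd l))"

lemma basis_carrier: "y \<in> X \<Longrightarrow> y \<in> carrier G"
  using basis by (auto simp: free_basis_def)

lemma letter_value_closed: "snd l \<in> X \<Longrightarrow> letter_value l \<in> carrier G"
  by (auto simp: letter_value_def basis_carrier)

lemma word_value_simps [simp]:
  "word_value G [] = \<one>" "word_value G (l # w) = letter_value l \<otimes> word_value G w"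
  by (simp_all add: word_value_def letter_value_def case_prod_unfold)

lemma word_value_closed: "set w \<subseteq> UNIV \<times> X \<Longrightarrow> word_value G w \<in> carrier G"
  by (induction w) (auto simp: letter_value_closed)

lemma nf_word_value: "w \<in> reduced_words X \<Longrightarrow> nf (word_value G w) = w"
  using basis by (simp add: nf_def free_basis_def bij_betw_def the_inv_into_f_f)

lemma nf_reduced: "g \<in> carrier G \<Longrightarrow> nf g \<in> reduced_words X"
  using basis unfolding nf_def free_basis_def
  by (metis bij_betw_def order_refl the_inv_into_into)

lemma nf_letters: "g \<in> carrier G \<Longrightarrow> set (nf g) \<subseteq> UNIV \<times> X"
  using nf_reduced by (auto simp: reduced_words_def)

lemma word_value_nf: "g \<in> carrier G \<Longrightarrow> word_value G (nf g) = g"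
  using basis unfolding nf_def free_basis_def by (metis bij_betw_def f_the_inv_into_f)

lemma nf_one: "nf \<one> = []"
  using nf_word_value[of "[]"] by (simp add: reduced_words_def)

text \<open>\<open>letter_cons\<close> keeps words reduced and has the right value, so uniqueness of
  reduced words applies.\<close>

lemma nf_letter_mult:
  assumes l: "snd l \<in> X" and g: "g \<in> carrier G"
  shows "nf (letter_value l \<otimes> g) = letter_cons l (nf g)"
proof -
  have r: "nf g \<in> reduced_words X" and v: "word_value G (nf g) = g"
    using g by (simp_all add: nf_reduced word_value_nf)
  have "letter_cons l (nf g) \<in> reduced_words X"
    using r l by (cases "nf g"; cases l)
      (auto simp: reduced_words_def letter_cons_def letter_inv_def successively_Cons)
  moreover have "word_value G (letter_cons l (nf g)) = letter_value l \<otimes> g"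
  proof (cases "nf g \<noteq> [] \<and> hd (nf g) = letter_inv l")
    case True
    then obtain w where w: "nf g = letter_inv l # w" by (cases "nf g") auto
    have wc: "word_value G w \<in> carrier G"
      using r w by (intro word_value_closed) (auto simp: reduced_words_def)
    have i: "letter_value l \<otimes> letter_value (letter_inv l) = \<one>"
      using l by (auto simp: letter_value_def letter_inv_def basis_carrier)
    have "letter_value l \<otimes> g = letter_value l \<otimes> (letter_value (letter_inv l) \<otimes> word_value G w)"
      using v w by simp
    also have "\<dots> = word_value G w"
      using i wc l by (simp add: m_assoc[symmetric] letter_value_closed)
    finally show ?thesis using w by (simp add: letter_cons_def)
  next
    case False
    then show ?thesis using v by (auto simp: letter_cons_def)
  qed
  ultimately show ?thesis using nf_word_value by metis
qed

lemma nf_word_mult: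
  "set w \<subseteq> UNIV \<times> X \<Longrightarrow> g \<in> carrier G \<Longrightarrow>
   nf (word_value G w \<otimes> g) = foldr letter_cons w (nf g)"
proof (induction w)
  case (Cons l w)
  then show ?case
    using nf_letter_mult[of l "word_value G w \<otimes> g"]
    by (auto simp: m_assoc letter_value_closed word_value_closed)
qed simp

lemma nf_mult:
  "h \<in> carrier G \<Longrightarrow> g \<in> carrier G \<Longrightarrow> nf (h \<otimes> g) = foldr letter_cons (nf h) (nf g)"
  using nf_word_mult[OF nf_letters, of h g] by (simp add: word_value_nf)

lemma nf_pow_mult:
  "snd l \<in> X \<Longrightarrow> g \<in> carrier G \<Longrightarrow>
   nf (letter_value l [^] (k :: nat) \<otimes> g) = (letter_cons l ^^ k) (nf g)"
proof (induction k)
  case (Suc k)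
  then have "letter_value l [^] Suc k \<otimes> g = letter_value l \<otimes> (letter_value l [^] k \<otimes> g)"
    using nat_pow_Suc2 by (simp only: m_assoc letter_value_closed nat_pow_closed)
  then show ?case
    using Suc nf_letter_mult[of l "letter_value l [^] k \<otimes> g"] by (simp add: letter_value_closed)
qed simp

lemma nf_gen_pow_mult:
  "y \<in> X \<Longrightarrow> g \<in> carrier G \<Longrightarrow> nf (y [^] (k :: nat) \<otimes> g) = (letter_cons (True, y) ^^ k) (nf g)"
  "y \<in> X \<Longrightarrow> g \<in> carrier G \<Longrightarrow>
   nf (inv y [^] (k :: nat) \<otimes> g) = (letter_cons (letter_inv (True, y)) ^^ k) (nf g)"
  using nf_pow_mult[of "(True, y)"] nf_pow_mult[of "letter_inv (True, y)"]
  by (simp_all add: letter_value_def letter_inv_def)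

lemma length_nf_mult_le:
  assumes "h \<in> carrier G" "g \<in> carrier G"
  shows "length (nf (h \<otimes> g)) \<le> length (nf h) + length (nf g)"
proof -
  have "length (foldr letter_cons u v) \<le> length u + length v" for u v :: "(bool \<times> 'a) list"
    by (induction u) (auto simp: letter_cons_def)
  then show ?thesis using assms by (simp add: nf_mult)
qed

text \<open>With at most one basis element, every group element is a power of a single
  \<open>y\<close>, and the group would be abelian.\<close>

lemma basis_two_elements:
  assumes "\<not> comm_group G"
  obtains a b where "a \<in> X" "b \<in> X" "a \<noteq> b"
proof -
  have False if eq: "\<forall>a \<in> X. \<forall>b \<in> X. a = b"
  proof -
    obtain y where y: "y \<in> carrier G" "X \<subseteq> {y}"
    proof (cases "X = {}")
      case True
      \<comment> \<open>An empty basis is covered by taking \<open>\<one>\<close> as the cyclic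
        generator.\<close>
      then show ?thesis using that[of \<one>] by simp
    next
      case False
      then obtain y where "y \<in> X" by blast
      then show ?thesis using that[of y] eq basis_carrier by blast
    qed
    have "\<exists>k :: int. word_value G w = y [^] k" if "set w \<subseteq> UNIV \<times> X" for w
      using that
    proof (induction w)
      case Nil
      show ?case by (intro exI[of _ 0]) simp
    next
      case (Cons l w)
      then obtain k :: int where k: "word_value G w = y [^] k" by auto
      have "snd l = y" using Cons.prems y by auto
      then have "letter_value l = y [^] (if fst l then 1 else - 1 :: int)"
        using y by (simp add: letter_value_def int_pow_neg)
      then show ?case
        using k y int_pow_mult[of y "if fst l then 1 else - 1" k] by (metis word_value_simps(2))
    qed
    then have c: "\<exists>k :: int. g = y [^] k" if "g \<in> carrier G" for g
      using that word_value_nf nf_letters by metis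
    have "g \<otimes> h = h \<otimes> g" if gh: "g \<in> carrier G" "h \<in> carrier G" for g h
    proof -
      obtain i j :: int where "g = y [^] i" "h = y [^] j" using c gh by blast
      then show ?thesis using y by (simp add: int_pow_mult[symmetric] add.commute)
    qed
    then show False using assms group_comm_groupI by blast
  qed
  then show ?thesis using that by blast
qed

section \<open>Blocks of high powers at the front of reduced words\<close>

text \<open>For a basis element \<open>y\<close>, these are the elements whose reduced word begins
  with exactly N letters \<open>y\<close>. Exactness, rather than at least N, is what
  \<open>power_cone_switch\<close> relies on.\<close>

definition power_cone :: "nat \<Rightarrow> 'a \<Rightarrow> 'a set" where
  "power_cone N y = {y [^] N \<otimes> r | r. r \<in> carrier G \<and> starts_off y (nf r)}"

lemma power_cone_closed: "y \<in> X \<Longrightarrow> q \<in> power_cone N y \<Longrightarrow> q \<in> carrier G"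
  by (auto simp: power_cone_def basis_carrier)

text \<open>A coefficient shorter than N cannot eat up the whole block: some \<open>y\<close>
  survives, behind a prefix \<open>u\<close> of fewer than N letters.\<close>

lemma nf_mult_power_cone:
  assumes y: "y \<in> X" and q: "q \<in> power_cone N y"
    and h: "h \<in> carrier G" "length (nf h) < N"
  obtains u k r where "nf (h \<otimes> q) = u @ replicate k (True, y) @ nf r" "k > 0" "length u < N"
    "r \<in> carrier G" "q = y [^] N \<otimes> r" "starts_off y (nf r)"
proof -
  obtain r where r: "r \<in> carrier G" "starts_off y (nf r)" "q = y [^] N \<otimes> r"
    using q by (auto simp: power_cone_def)
  have "nf q = replicate N (True, y) @ nf r"
    using r y by (auto simp: nf_gen_pow_mult starts_off_def intro!: letter_cons_push)
  then have "nf (h \<otimes> q) = foldr letter_cons (nf h) (replicate N (True, y) @ nf r)"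
    using nf_mult[OF h(1) power_cone_closed[OF y q]] by simp
  then obtain u k where "nf (h \<otimes> q) = u @ replicate k (True, y) @ nf r"
    "N \<le> k + length (nf h)" "length u \<le> length (nf h)"
    using foldr_letter_cons_replicate[of "nf h" N "(True, y)" "nf r"] h(2) by auto
  then show ?thesis using h(2) r by (intro that[of u k r]) auto
qed

lemma mult_power_cone_neq_one:
  assumes "y \<in> X" "q \<in> power_cone N y" "h \<in> carrier G" "length (nf h) < N"
  shows "h \<otimes> q \<noteq> \<one>"
proof -
  obtain u k r where "nf (h \<otimes> q) = u @ replicate k (True, y) @ nf r" "k > 0"
    by (rule nf_mult_power_cone[OF assms])
  then have "nf (h \<otimes> q) \<noteq> nf \<one>" by (simp add: nf_one)
  then show ?thesis by metis
qed

text \<open>Base case of the suffix induction: \<open>h\<close> is too short to absorb all of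
  \<open>inv z [^] N\<close>, so a letter \<open>inv z\<close> separates the block of
  \<open>y\<close> from what follows.\<close>

lemma power_cone_start:
  assumes "y \<in> X" "z \<in> X" "y \<noteq> z" and h: "h \<in> carrier G" "length (nf h) < N"
  shows "y [^] N \<otimes> (inv z [^] N \<otimes> h) \<in> power_cone N y"
proof -
  obtain p v where v: "nf h = replicate p (True, z) @ v" "v = [] \<or> hd v \<noteq> (True, z)"
    by (rule letter_run)
  then have "p < N" using h(2) by simp
  from letter_cons_run_less[OF this v(2)] have "starts_off y (nf (inv z [^] N \<otimes> h))"
    using assms v(1) by (auto simp: nf_gen_pow_mult starts_off_def)
  then show ?thesis using assms by (auto simp: power_cone_def basis_carrier)
qed

text \<open>Case of two equal consecutive exponents. The surviving \<open>y\<close> of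
  \<open>q\<close> stops any leading run of \<open>z\<close> before it reaches length N, so a letter
  \<open>inv z\<close> remains in front; \<open>h\<close> may be trivial here.\<close>

lemma power_cone_same:
  assumes y: "y \<in> X" and z: "z \<in> X" and "y \<noteq> z" and h: "h \<in> carrier G" "length (nf h) < N"
    and q: "q \<in> power_cone N y"
  shows "y [^] N \<otimes> (inv z [^] N \<otimes> (h \<otimes> q)) \<in> power_cone N y"
proof -
  obtain u k r where u: "nf (h \<otimes> q) = u @ replicate k (True, y) @ nf r" "k > 0" "length u < N"
    by (rule nf_mult_power_cone[OF y q h])
  obtain p v where v: "nf (h \<otimes> q) = replicate p (True, z) @ v" "v = [] \<or> hd v \<noteq> (True, z)"
    by (rule letter_run)
  \<comment> \<open>A longer run would put a letter \<open>z\<close> at position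
    \<open>length u\<close>, where the surviving block has \<open>y\<close>.\<close>
  have "p \<le> length u"
  proof (rule ccontr)
    assume "\<not> p \<le> length u"
    then have "nf (h \<otimes> q) ! length u = (True, z)" using v(1) by (simp add: nth_append)
    moreover have "nf (h \<otimes> q) ! length u = (True, y)" using u(1,2) by (simp add: nth_append)
    ultimately show False using \<open>y \<noteq> z\<close> by simp
  qed
  then have "p < N" using u(3) by simp
  have hq: "h \<otimes> q \<in> carrier G" using h q y power_cone_closed by auto
  from letter_cons_run_less[OF \<open>p < N\<close> v(2)] have "starts_off y (nf (inv z [^] N \<otimes> (h \<otimes> q)))"
    using assms(3) z v(1) hq by (auto simp: nf_gen_pow_mult starts_off_def)
  then show ?thesis using z hq by (auto simp: power_cone_def basis_carrier)
qed

text \<open>Case of opposite exponents, where \<open>inv y [^] N\<close> meets the block of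
  \<open>q\<close>. Unless the leading run of \<open>y\<close> in \<open>h \<otimes> q\<close> has
  length exactly N, a letter \<open>y\<close> or \<open>inv y\<close> remains in front; exact length
  N would force \<open>h = \<one>\<close>.\<close>

lemma power_cone_switch:
  assumes y: "y \<in> X" and z: "z \<in> X" and "y \<noteq> z" and h: "h \<in> carrier G" "length (nf h) < N"
    and h1: "h \<noteq> \<one>" and q: "q \<in> power_cone N y"
  shows "z [^] N \<otimes> (inv y [^] N \<otimes> (h \<otimes> q)) \<in> power_cone N z"
proof -
  obtain u k r where u: "nf (h \<otimes> q) = u @ replicate k (True, y) @ nf r" "k > 0" "length u < N"
    and r: "r \<in> carrier G" "q = y [^] N \<otimes> r" "starts_off y (nf r)"
    by (rule nf_mult_power_cone[OF y q h])
  obtain p v where v: "nf (h \<otimes> q) = replicate p (True, y) @ v" "v = [] \<or> hd v \<noteq> (True, y)"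
    by (rule letter_run)
  have hq: "h \<otimes> q \<in> carrier G" and qc: "q \<in> carrier G" using h q y power_cone_closed by auto
  have "p \<noteq> N"
  proof
    assume p: "p = N"
    \<comment> \<open>Since \<open>u\<close> is shorter than the run, it consists of letters
      \<open>y\<close> only. Comparing the remainders of the two runs then gives
      \<open>h \<otimes> q\<close> the same reduced word as \<open>q\<close>.\<close>
    have "u = take (length u) (nf (h \<otimes> q))" using u(1) by simp
    also have "\<dots> = replicate (length u) (True, y)"
      using v(1) u(3) p by simp
    finally have "replicate (length u + k) (True, y) @ nf r = replicate N (True, y) @ v"
      using u(1) v(1) p by (metis append_assoc replicate_add)
    moreover have "nf r = [] \<or> hd (nf r) \<noteq> (True, y)"
      using r(3) by (auto simp: starts_off_def)
    ultimately have "nf r = v" using v(2) by (metis dropWhile_run)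
    then have "nf (h \<otimes> q) = nf q"
      using v(1) p r y by (auto simp: nf_gen_pow_mult starts_off_def intro!: letter_cons_push[symmetric])
    then have "h \<otimes> q = q" using hq qc word_value_nf by metis
    then show False using h(1) h1 qc by simp
  qed
  then consider "p < N" | "N < p" by linarith
  then obtain l w where "nf (inv y [^] N \<otimes> (h \<otimes> q)) = l # w" "snd l = y"
  proof cases
    case 1
    from letter_cons_run_less[OF this v(2)] show ?thesis
      using that[of "letter_inv (True, y)"] v(1) y hq by (auto simp: nf_gen_pow_mult)
  next
    case 2
    from letter_cons_run_greater[OF this, of "(True, y)" v] show ?thesis
      using that[of "(True, y)"] v(1) y hq by (auto simp: nf_gen_pow_mult)
  qed
  then have "starts_off z (nf (inv y [^] N \<otimes> (h \<otimes> q)))"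
    using \<open>y \<noteq> z\<close> by (auto simp: starts_off_def)
  then show ?thesis using y hq by (auto simp: power_cone_def basis_carrier)
qed

lemma syllable_prod_power_cone:
  fixes N :: nat
  assumes ab: "a \<in> X" "b \<in> X" "a \<noteq> b"
  defines "g \<equiv> a [^] N \<otimes> inv b [^] N"
  assumes "snd ` set es \<subseteq> carrier G" "\<forall>h \<in> snd ` set es. length (nf h) < N"
    "reduced_syllables G es" "es \<noteq> []"
  shows "syllable_prod G (\<lambda>h. h) g es \<in> power_cone N (if fst (hd es) then a else b)"
  using assms(5-)
proof (induction es)
  case (Cons c es)
  obtain e h where c: "c = (e, h)" by (cases c)
  define y z where "y = (if e then a else b)" and "z = (if e then b else a)"
  have yz: "y \<in> X" "z \<in> X" "y \<noteq> z" using ab by (auto simp: y_def z_def)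
  have h: "h \<in> carrier G" "length (nf h) < N" using Cons.prems c by auto
  have abc: "a \<in> carrier G" "b \<in> carrier G" using ab basis_carrier by auto
  \<comment> \<open>Inverting g = a^N b^-N gives b^N a^-N, so both exponents have one shape with the
    roles of \<open>a\<close> and \<open>b\<close> exchanged.\<close>
  have "(if e then g else inv g) = y [^] N \<otimes> inv z [^] N"
    using abc by (auto simp: g_def y_def z_def inv_mult_group nat_pow_inv)
  then have step: "(if e then g else inv g) \<otimes> k = y [^] N \<otimes> (inv z [^] N \<otimes> k)"
    if "k \<in> carrier G" for k
    using that abc by (simp add: m_assoc y_def z_def)
  show ?case
  proof (cases es)
    case Nil
    then show ?thesis
      using power_cone_start[OF yz h] h step[of h] by (simp add: c y_def[symmetric])
  next
    case (Cons c' es')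
    obtain e' h' where c': "c' = (e', h')" by (cases c')
    define q where "q = syllable_prod G (\<lambda>h. h) g es"
    have q: "q \<in> power_cone N (if e' then a else b)"
      using Cons.IH Cons.prems Cons c' by (auto simp: q_def successively_Cons)
    then have "q \<in> carrier G" using ab power_cone_closed[of "if e' then a else b" q N] by auto
    moreover have "y [^] N \<otimes> (inv z [^] N \<otimes> (h \<otimes> q)) \<in> power_cone N y"
    proof (cases "e' = e")
      case True
      then show ?thesis using power_cone_same[OF yz h] q by (simp add: y_def)
    next
      case False
      \<comment> \<open>Reducedness of the syllables enters here. The block of \<open>q\<close> is
        one of \<open>z\<close>, so the switching lemma is applied with \<open>y\<close> and
        \<open>z\<close> exchanged.\<close>
      then have "h \<noteq> \<one>" using Cons.prems Cons c c' by auto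
      moreover have "q \<in> power_cone N z" using q False by (auto simp: z_def split: if_splits)
      ultimately show ?thesis
        using power_cone_switch[OF yz(2,1) yz(3)[symmetric] h] by blast
    qed
    ultimately show ?thesis
      using step[of "h \<otimes> q"] h by (simp add: c y_def[symmetric] q_def[symmetric])
  qed
qed simp

lemma syllable_value_neq_one:
  assumes ab: "a \<in> X" "b \<in> X" "a \<noteq> b"
    and h: "h \<in> carrier G" "length (nf h) < N"
    and es: "snd ` set es \<subseteq> carrier G" "\<forall>h \<in> snd ` set es. length (nf h) < N"
      "reduced_syllables G es"
    and ne: "es = [] \<Longrightarrow> h \<noteq> \<one>"
  shows "h \<otimes> syllable_prod G (\<lambda>h. h) (a [^] N \<otimes> inv b [^] N) es \<noteq> \<one>"
proof (cases "es = []")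
  case True
  then show ?thesis using ne h by simp
next
  case False
  then show ?thesis
    using mult_power_cone_neq_one[OF _ syllable_prod_power_cone[OF ab es False] h] ab by simp
qed

end

section \<open>The growth function\<close>

context group
begin

lemma mixed_var_closed: "mixed_var G \<in> carrier (mixed_words G)"
  using hom_in_carrier[OF fp_inr_hom[OF is_group group_integer_group], of 1]
  by (simp add: mixed_var_def)

lemma group_hom_inl: "group_hom G (mixed_words G) (fp_inl G integer_group)"
  by (simp add: group_hom_def group_hom_axioms_def is_group group_free_product fp_inl_hom)

lemma group_hom_mixed_eval:
  "g \<in> carrier G \<Longrightarrow> group_hom (mixed_words G) G (\<lambda>w. mixed_eval G w g)"
  by (simp add: group_hom_def group_hom_axioms_def is_group group_free_product mixed_eval_hom)

text \<open>Needed for \<open>mixed_word_length\<close> to be attained by a word. Constants come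
  from the images of \<open>S\<close>, the cyclic factor from powers of the variable, and every
  class is the product of the classes of its letters.\<close>

lemma mixed_words_generated:
  assumes S: "S \<subseteq> carrier G" "generate G S = carrier G"
    and w: "w \<in> carrier (mixed_words G)"
  shows "w \<in> generate (mixed_words G) (insert (mixed_var G) (fp_inl G integer_group ` S))"
    (is "_ \<in> ?gen")
proof -
  interpret L: group_hom G "mixed_words G" "fp_inl G integer_group" by (rule group_hom_inl)
  have T: "insert (mixed_var G) (fp_inl G integer_group ` S) \<subseteq> carrier (mixed_words G)"
    using mixed_var_closed S by auto
  have sub: "subgroup ?gen (mixed_words G)" by (rule L.H.generate_is_subgroup[OF T])
  have inl: "fp_inl G integer_group a \<in> ?gen" if "a \<in> carrier G" for a
  proof -
    have "fp_inl G integer_group ` carrier G = generate (mixed_words G) (fp_inl G integer_group ` S)"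
      using L.generate_img[OF S(1)] S(2) by simp
    then show ?thesis using that L.H.mono_generate[of "fp_inl G integer_group ` S"] by blast
  qed
  have inr: "fp_inr G integer_group k \<in> ?gen" for k :: int
  proof -
    interpret R: group_hom integer_group "mixed_words G" "fp_inr G integer_group"
      by (simp add: group_hom_def group_hom_axioms_def is_group group_free_product fp_inr_hom)
    have "fp_inr G integer_group k = mixed_var G [^]\<^bsub>mixed_words G\<^esub> k"
      using R.hom_int_pow[of 1 k] by (simp add: mixed_var_def)
    moreover have "mixed_var G \<in> ?gen" by (simp add: generate.incl)
    ultimately show ?thesis
      using L.H.subgroup_int_pow_closed[OF sub] by simp
  qed
  obtain u where u: "u \<in> fp_words G integer_group" "w = fp_rel G integer_group `` {u}"
    using fp_carrierE[OF is_group group_integer_group w] .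
  have "fp_rel G integer_group `` {u} \<in> ?gen" using u(1)
  proof (induction u rule: list.induct)
    case Nil
    show ?case
      using subgroup.one_closed[OF sub] by (simp add: fp_one[OF is_group group_integer_group])
  next
    case (Cons c u)
    have c: "[c] \<in> fp_words G integer_group" and u: "u \<in> fp_words G integer_group"
      using Cons.prems by auto
    have "fp_rel G integer_group `` {[c]} \<in> ?gen"
      using c inl inr by (cases c) (auto simp: fp_inl_def fp_inr_def)
    then show ?case
      using fp_mult_class[OF is_group group_integer_group c u] Cons.IH[OF u]
        subgroup.m_closed[OF sub] by (metis append_Cons append_Nil)
  qed
  then show ?thesis using u by simp
qed

lemma mixed_eval_syllable_prod:
  assumes g: "g \<in> carrier G" and es: "snd ` set es \<subseteq> carrier G"
  shows "mixed_eval G (syllable_prod (mixed_words G) (fp_inl G integer_group) (mixed_var G) es) g =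
    syllable_prod G (\<lambda>h. h) g es"
  using es
proof (induction es)
  case Nil
  interpret E: group_hom "mixed_words G" G "\<lambda>w. mixed_eval G w g"
    by (rule group_hom_mixed_eval[OF g])
  show ?case using E.hom_one by simp
next
  case (Cons c es)
  interpret L: group_hom G "mixed_words G" "fp_inl G integer_group" by (rule group_hom_inl)
  interpret E: group_hom "mixed_words G" G "\<lambda>w. mixed_eval G w g"
    by (rule group_hom_mixed_eval[OF g])
  obtain e h where c: "c = (e, h)" by (cases c)
  have "syllable_prod (mixed_words G) (fp_inl G integer_group) (mixed_var G) es
      \<in> carrier (mixed_words G)"
    using Cons.prems mixed_var_closed by (intro L.syllable_prod_closed) auto
  then show ?case
    using Cons c mixed_var_closed
    by (auto simp: mixed_eval_const[OF g] mixed_eval_var[OF g])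
qed

end

section \<open>A point where short mixed words do not vanish\<close>

text \<open>A shortest word for \<open>w\<close> is brought into syllable form; its coefficients
  then have basis length at most \<open>D * mixed_word_length G S w\<close>. The point depends on
  \<open>w\<close> only through a bound on its length.\<close>

lemma (in group_with_free_basis) mixed_eval_neq_one:
  assumes ab: "a \<in> X" "b \<in> X" "a \<noteq> b"
    and S: "S \<subseteq> carrier G" "generate G S = carrier G"
    and D: "\<And>s. s \<in> S \<union> m_inv G ` S \<Longrightarrow> length (nf s) \<le> D"
    and w: "w \<in> carrier (mixed_words G)" "w \<noteq> \<one>\<^bsub>mixed_words G\<^esub>"
    and N: "D * mixed_word_length G S w < N"
  shows "mixed_eval G w (a [^] N \<otimes> inv b [^] N) \<noteq> \<one>"
proof -
  interpret L: group_hom G "mixed_words G" "fp_inl G integer_group" by (rule group_hom_inl)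
  let ?T = "insert (mixed_var G) (fp_inl G integer_group ` S)"
  have "?T \<subseteq> carrier (mixed_words G)" using mixed_var_closed S by auto
  then obtain ws where ws: "set ws \<subseteq> ?T \<union> m_inv (mixed_words G) ` ?T"
    "list_prod (mixed_words G) ws = w" "length ws = mixed_word_length G S w"
    using L.H.word_length_witness mixed_words_generated[OF S w(1)]
    unfolding mixed_word_length_def by blast
  have "length (nf (s \<otimes> g)) \<le> D + length (nf g)"
    if "s \<in> S \<union> m_inv G ` S" "g \<in> carrier G" for s g
  proof -
    have "s \<in> carrier G" using that S by auto
    then show ?thesis using length_nf_mult_le[of s g] D[of s] that by force
  qed
  then obtain h es where h: "h \<in> carrier G" and es: "snd ` set es \<subseteq> carrier G"
    "reduced_syllables G es"
    and len: "\<forall>g' \<in> insert h (snd ` set es). length (nf g') \<le> D * length ws"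
    and eq: "w = fp_inl G integer_group h \<otimes>\<^bsub>mixed_words G\<^esub>
      syllable_prod (mixed_words G) (fp_inl G integer_group) (mixed_var G) es"
    using L.syllable_form[OF mixed_var_closed S(1) _ _ ws(1), of "\<lambda>g. length (nf g)" D] ws(2)
    by (auto simp: nf_one)
  let ?g = "a [^] N \<otimes> inv b [^] N"
  have g: "?g \<in> carrier G" using ab basis_carrier by simp
  interpret E: group_hom "mixed_words G" G "\<lambda>w. mixed_eval G w ?g"
    by (rule group_hom_mixed_eval[OF g])
  have "h \<noteq> \<one>" if "es = []" using w(2) eq that by auto
  moreover have "length (nf h) < N" "\<forall>h \<in> snd ` set es. length (nf h) < N"
    using len N ws(3) by fastforce+
  ultimately have "h \<otimes> syllable_prod G (\<lambda>h. h) ?g es \<noteq> \<one>"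
    using syllable_value_neq_one[OF ab h _ es(1) _ es(2)] by blast
  moreover have "mixed_eval G w ?g = h \<otimes> syllable_prod G (\<lambda>h. h) ?g es"
    using L.syllable_prod_closed[OF mixed_var_closed es(1)] h
    by (simp add: eq mixed_eval_const[OF g] mixed_eval_syllable_prod[OF g es(1)])
  ultimately show ?thesis by simp
qed

theorem theorem1p10:
  fixes G :: "('a, 'm) monoid_scheme" and S :: "'a set"
  assumes "free_group_of_finite_rank G"
    and "\<not> comm_group G"
    and "finite S" and "S \<subseteq> carrier G" and "generate G S = carrier G"
  shows "mixed_identity_free G \<and>
    (\<exists>C :: real. C > 0 \<and> (\<forall>n :: nat. n \<ge> 2 \<longrightarrow>
       real (mif_growth G S n) \<le> C * real n * ln (real n)))"
proof -
  obtain X where "group G" "free_basis G X"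
    using assms(1) by (auto simp: free_group_of_finite_rank_def)
  then interpret group_with_free_basis G X
    by (simp add: group_with_free_basis_def group_with_free_basis_axioms_def)
  note S = assms(4,5)
  obtain a b where ab: "a \<in> X" "b \<in> X" "a \<noteq> b" using basis_two_elements[OF assms(2)] .
  then have abc: "a \<in> carrier G" "b \<in> carrier G" using basis_carrier by auto
  \<comment> \<open>Largest basis length of a letter from \<open>S\<close>; the inserted 0 ensures
    that \<open>Max\<close> is taken over a nonempty set.\<close>
  define D where "D = Max (insert 0 ((length \<circ> nf) ` (S \<union> m_inv G ` S)))"
  have D: "length (nf s) \<le> D" if "s \<in> S \<union> m_inv G ` S" for s
    unfolding D_def using assms(3) that by (intro Max_ge) auto
  note neq = mixed_eval_neq_one[OF ab S D]
  \<comment> \<open>Here \<open>lessI\<close> chooses N as the successor of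
    \<open>D * mixed_word_length G S w\<close>.\<close>
  have "mixed_identity_free G"
    unfolding mixed_identity_free_def mixed_identity_def using neq[OF _ _ _ lessI] abc by fastforce
  moreover
  define L where "L = word_length G S a + word_length G S (inv\<^bsub>G\<^esub> b)"
  have complexity: "mixed_complexity G S w \<le> (D + 1) * n * L"
    if w: "w \<in> carrier (mixed_words G)" "w \<noteq> \<one>\<^bsub>mixed_words G\<^esub>"
      and n: "mixed_word_length G S w \<le> n" "n \<ge> 2" for w n
  proof -
    \<comment> \<open>Large enough for every \<open>w\<close> of length at most \<open>n\<close>,
      yet at most \<open>(D + 1) * n\<close>, so the evaluation point has length linear in
      \<open>n\<close> with respect to \<open>S\<close>.\<close>
    define N where "N = Suc (D * n)"
    let ?g = "a [^]\<^bsub>G\<^esub> N \<otimes>\<^bsub>G\<^esub> inv\<^bsub>G\<^esub> b [^]\<^bsub>G\<^esub> N"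
    have "mixed_eval G w ?g \<noteq> \<one>\<^bsub>G\<^esub>"
      using n by (intro neq w) (auto simp: N_def less_Suc_eq_le)
    then have "mixed_complexity G S w \<le> word_length G S ?g"
      unfolding mixed_complexity_def using abc by (intro Least_le bexI[of _ ?g]) auto
    also have "\<dots> \<le> word_length G S (a [^]\<^bsub>G\<^esub> N) + word_length G S (inv\<^bsub>G\<^esub> b [^]\<^bsub>G\<^esub> N)"
      using abc S by (intro word_length_mult_le) auto
    also have "\<dots> \<le> N * word_length G S a + N * word_length G S (inv\<^bsub>G\<^esub> b)"
      using abc S by (intro add_mono word_length_pow_le) auto
    also have "\<dots> = N * L" by (simp add: L_def algebra_simps)
    also have "\<dots> \<le> (D + 1) * n * L" using n by (intro mult_right_mono) (auto simp: N_def)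
    finally show ?thesis .
  qed
  have growth: "mif_growth G S n \<le> (D + 1) * n * L" if n: "n \<ge> 2" for n
  proof -
    let ?M = "{mixed_complexity G S w | w. w \<in> carrier (mixed_words G) \<and>
      w \<noteq> \<one>\<^bsub>mixed_words G\<^esub> \<and> mixed_word_length G S w \<le> n}"
    have le: "\<forall>k \<in> ?M. k \<le> (D + 1) * n * L" using complexity n by auto
    \<comment> \<open>The \<open>Max\<close> in \<open>mif_growth\<close> is meaningful only for a
      finite nonempty set. Finiteness comes from the uniform bound, nonemptiness from the variable
      itself, which is nontrivial because it takes the value \<open>a\<close> at
      \<open>a\<close>.\<close>
    have "?M \<subseteq> {..(D + 1) * n * L}" using le by auto
    then have fin: "finite ?M" by (rule finite_subset) simp
    have "a \<noteq> \<one>\<^bsub>G\<^esub>"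
      using nf_word_value[of "[(True, a)]"] nf_one ab abc
      by (auto simp: reduced_words_def letter_value_def)
    then have "mixed_var G \<noteq> \<one>\<^bsub>mixed_words G\<^esub>"
      using mixed_eval_var[OF abc(1)] group_hom.hom_one[OF group_hom_mixed_eval[OF abc(1)]] by metis
    moreover have "mixed_word_length G S (mixed_var G) \<le> n"
      using word_length_le[of "[mixed_var G]" "insert (mixed_var G) (fp_inl G integer_group ` S)"
          "mixed_words G"] n mixed_var_closed
        group.is_monoid[OF group_free_product[OF is_group group_integer_group]]
      by (simp add: mixed_word_length_def monoid.r_one)
    ultimately have "?M \<noteq> {}" using mixed_var_closed by blast
    then show ?thesis unfolding mif_growth_def using Max_le_iff[OF fin] le by blast
  qed
  \<comment> \<open>Dividing by \<open>ln 2\<close> turns the linear bound into the stated one, as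
    \<open>ln 2 \<le> ln (real n)\<close> for \<open>n \<ge> 2\<close>; the summand 1 makes
    positivity immediate.\<close>
  define C where "C = (real ((D + 1) * L) + 1) / ln 2"
  have "C > 0" by (simp add: C_def add_nonneg_pos)
  moreover have "real (mif_growth G S n) \<le> C * real n * ln (real n)" if n: "n \<ge> 2" for n
  proof -
    have "real (mif_growth G S n) \<le> real ((D + 1) * n * L)" using growth[OF n] by linarith
    also have "\<dots> = real ((D + 1) * L) * real n" by (simp add: algebra_simps)
    also have "\<dots> \<le> (C * ln 2) * real n" by (intro mult_right_mono) (auto simp: C_def)
    also have "\<dots> \<le> C * real n * ln (real n)"
      using n \<open>C > 0\<close> by (simp add: mult_left_mono)
    finally show ?thesis .
  qed
  ultimately show ?thesis by blast
qed

end
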